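(* Let $m,n\in\mathbb{N}$ with $m\ge n$. There is an open and dense subset $\mathcal{A}\subset\mathbb{R}^{n\times m}$ such that for all $A=[x_1,\ldots,x_m]\in\mathcal{A}$ (with columns $x_j\in\mathbb{R}^n$), all choices of labels $y_j\in\{-1,1\}$, $j=1,\ldots,m$, and all $d\in\mathbb{N}$ satisfying $\binom{n+d-1}{d}\ge m$, there exists a polynomial kernel perceptron $$f_p(x)=\sigma\left(\sum_{i=1}^m\alpha_iy_i\langle x_i,x\rangle^d+b\right)$$ with real parameters $\alpha_1,\ldots,\alpha_m,b$ such that $f_p(x_j)=y_j$ for all $j=1,\ldots,m$.
   Context: $\mathbb{N}=\{1,2,3,\ldots\}$; $\langle\cdot,\cdot\rangle$ is the canonical scalar product on $\mathbb{R}^n$. The activation function is $\sigma(z)=1$ for $z\ge0$ and $\sigma(z)=-1$ for $z<0$. *)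

theory Defs
  imports "HOL-Analysis.Analysis"
begin

definition activation :: "real \<Rightarrow> real" where
  "activation z = (if z \<ge> 0 then 1 else - 1)"

text \<open>
  The training points \<open>x\<^sub>1, \<dots>, x\<^sub>m\<close> in \<open>\<real>\<^sup>n\<close> are the columns of the \<open>n \<times> m\<close> matrix \<open>A\<close>, which
  has type \<open>real ^ 'm ^ 'n\<close> (the row index is the outer type).
\<close>

definition poly_kernel_perceptron ::
  "real ^ 'm ^ 'n \<Rightarrow> ('m \<Rightarrow> real) \<Rightarrow> nat \<Rightarrow> ('m \<Rightarrow> real) \<Rightarrow> real \<Rightarrow> real ^ 'n \<Rightarrow> real" where
  "poly_kernel_perceptron A y d \<alpha> b x =
     activation ((\<Sum>i\<in>UNIV. \<alpha> i * y i * (column i A \<bullet> x) ^ d) + b)"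

end

theory Submission
  imports Defs
begin

text \<open>
  Write \<open>K\<^sub>d(A)\<close> for the matrix with entries \<open>\<langle>x\<^sub>i, x\<^sub>j\<rangle>\<^sup>d\<close>. If it is invertible, then already without
  an offset (\<open>b = 0\<close>) the kernel expansion can be given prescribed values at all training points, in
  particular the labels themselves. So it suffices to find an open dense set of matrices \<open>A\<close> on which
  \<open>K\<^sub>d(A)\<close> is invertible simultaneously for every admissible degree \<open>d\<close>. There are infinitely many of
  these, so intersecting the individual sets could destroy openness. Two facts resolve this.

  First, \<open>K\<^sub>d(A)\<close> is the Gram matrix of the tensor powers of the points: its kernel consists of the
  coefficient vectors \<open>c\<close> with \<open>\<Sum> c\<^sub>i x\<^sub>i\<^sup>\<otimes>\<^sup>d = 0\<close>, equivalently those for which \<open>\<Sum> c\<^sub>i p(x\<^sub>i) = 0\<close> for every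
  product \<open>p\<close> of \<open>d\<close> linear forms (\<open>kernel_matrix_kernel_annihilates_products\<close>). Contracting such a
  relation in degree \<open>d + 1\<close> with a point gives one in degree \<open>d\<close>, so invertibility passes from each
  positive degree to all higher ones (\<open>det_kernel_matrix_nonzero_mono\<close>). Hence only the least
  admissible degree \<open>e\<close> matters.

  Second, \<open>det K\<^sub>e(A)\<close> is a polynomial in the entries of \<open>A\<close>, and the set where a polynomial does not
  vanish is open, and dense unless it is empty (\<open>open_dense_nonzero_polynomial\<close>). It is not empty: the
  points with nonnegative integer coordinates of sum \<open>e\<close> number \<open>n + e - 1\<close> choose \<open>e\<close>, which is at
  least \<open>m\<close>, and for each of them there is a product of \<open>e\<close> linear forms that vanishes at all the others but not at it
  (\<open>lattice_point_dual_form\<close>). By the first fact any \<open>m\<close> distinct ones have an invertible kernel matrix.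
\<close>

section \<open>Zero sets of polynomial functions\<close>

text \<open>
  Density is a one-variable matter: on the line from an arbitrary point \<open>x\<close> to \<open>w\<close> the function is a
  polynomial that is nonzero at \<open>w\<close>, so it has finitely many roots and is nonzero arbitrarily close
  to \<open>x\<close>.
\<close>

lemma open_dense_nonzero_polynomial:
  fixes P :: "'a::real_normed_vector \<Rightarrow> real"
  assumes P: "real_polynomial_function P" and nz: "P w \<noteq> 0"
  shows "open {x. P x \<noteq> 0}" and "closure {x. P x \<noteq> 0} = UNIV"
proof -
  have "continuous_on UNIV P"
    using P continuous_on_polymonial_function real_polynomial_function_eq by blast
  then show "open {x. P x \<noteq> 0}"
    by (intro open_Collect_neq) auto
next
  have "x \<in> closure {x. P x \<noteq> 0}" for x
  proof -
    define g where "g t = x + t *\<^sub>R (w - x)" for t :: real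
    have g: "polynomial_function g"
      unfolding g_def by (intro polynomial_function_add polynomial_function_mult)
        (auto intro: polynomial_function_const polynomial_function_bounded_linear)
    have "real_polynomial_function (P \<circ> g)"
      using P g polynomial_function_compose[of g P] by (simp add: real_polynomial_function_eq)
    then obtain a n where an: "P (g t) = (\<Sum>i\<le>n. a i * t ^ i)" for t
      unfolding real_polynomial_function_iff_sum by (auto simp: fun_eq_iff)
    have "P (g 1) \<noteq> 0"
      using nz by (simp add: g_def)
    then have "\<exists>i\<le>n. a i \<noteq> 0"
      unfolding an by (metis (no_types, lifting) atMost_iff mult_zero_left sum.neutral)
    then have "finite {t. P (g t) = 0}"
      unfolding an polyfun_finite_roots by blast
    then have "\<forall>\<^sub>F t in at 0. P (g t) \<noteq> 0"
      using islimpt_finite[of "{t. P (g t) = 0}" 0]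
      by (auto simp: islimpt_iff_eventually)
    moreover have "(g \<longlongrightarrow> x) (at 0)"
      unfolding g_def by (auto intro!: tendsto_eq_intros)
    ultimately show ?thesis
      by (intro Lim_in_closed_set[where F = "at 0" and f = g])
        (auto elim!: eventually_mono intro: closure_subset[THEN subsetD])
  qed
  then show "closure {x. P x \<noteq> 0} = UNIV"
    by blast
qed

section \<open>Kernel matrices\<close>

definition kernel_matrix :: "nat \<Rightarrow> real ^ 'm ^ 'n \<Rightarrow> real ^ 'm ^ 'm" where
  "kernel_matrix d A = (\<chi> j i. (column i A \<bullet> column j A) ^ d)"

lemma real_polynomial_function_power:
  "real_polynomial_function f \<Longrightarrow> real_polynomial_function (\<lambda>x. f x ^ k)"
  by (induction k) auto

lemma real_polynomial_function_det_kernel_matrix: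
  "real_polynomial_function (\<lambda>A :: real ^ 'm ^ 'n. det (kernel_matrix d A))"
proof -
  have entry: "real_polynomial_function (\<lambda>A :: real ^ 'm ^ 'n. A $ k $ i)" for k i
    by (intro real_polynomial_function.intros(1) bounded_linear_compose[OF bounded_linear_vec_nth bounded_linear_vec_nth])
  have inner: "real_polynomial_function (\<lambda>A :: real ^ 'm ^ 'n. column i A \<bullet> column j A)" for i j
    unfolding column_def inner_vec_def
    by (simp, rule real_polynomial_function_sum[OF finite])
      (rule real_polynomial_function.intros(4)[OF entry entry])
  have "real_polynomial_function (\<lambda>A :: real ^ 'm ^ 'n. kernel_matrix d A $ j $ i)" for i j
    using real_polynomial_function_power[OF inner] by (simp add: kernel_matrix_def)
  then show ?thesis
    unfolding det_def
    by (intro real_polynomial_function_sum real_polynomial_function.intros(4)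
        real_polynomial_function.intros(2) real_polynomial_function_prod)
      (simp_all add: finite_permutations)
qed

lemma det_kernel_matrix_nonzero_iff:
  fixes A :: "real ^ 'm ^ 'n"
  shows "det (kernel_matrix d A) \<noteq> 0 \<longleftrightarrow>
    (\<forall>c. (\<forall>j. (\<Sum>i\<in>UNIV. c i * (column i A \<bullet> column j A) ^ d) = 0) \<longrightarrow> (\<forall>i. c i = 0))"
proof -
  have "det (kernel_matrix d A) \<noteq> 0 \<longleftrightarrow> (\<forall>x. kernel_matrix d A *v x = 0 \<longrightarrow> x = 0)"
    by (metis invertible_det_nz invertible_left_inverse matrix_left_invertible_ker)
  also have "\<dots> \<longleftrightarrow> (\<forall>c. kernel_matrix d A *v (\<chi> i. c i) = 0 \<longrightarrow> (\<chi> i. c i) = (0 :: real ^ 'm))"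
    by (metis vec_lambda_eta)
  also have "\<dots> \<longleftrightarrow> (\<forall>c. (\<forall>j. (\<Sum>i\<in>UNIV. c i * (column i A \<bullet> column j A) ^ d) = 0) \<longrightarrow> (\<forall>i. c i = 0))"
    by (simp add: kernel_matrix_def matrix_vector_mult_def vec_eq_iff mult.commute)
  finally show ?thesis .
qed

text \<open>
  The entries \<open>\<langle>x\<^sub>i, x\<^sub>j\<rangle>\<^sup>d\<close> are the inner products of the tensor powers of the points. With
  \<open>S = \<Sum> c\<^sub>i x\<^sub>i\<^sup>\<otimes>\<^sup>d\<close>, the hypothesis gives \<open>\<langle>S, S\<rangle> = 0\<close>, so \<open>S = 0\<close>; and the sum in
  the conclusion is the pairing of \<open>S\<close> with the tensor product of the vectors \<open>v t\<close>. An arbitrary index set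
  \<open>T\<close> of size \<open>d\<close> for the tensor factors lets later uses pick the indexing that suits their forms.
\<close>

lemma kernel_matrix_kernel_annihilates_products:
  fixes x :: "'i::finite \<Rightarrow> real ^ 'n" and T :: "'t set"
  assumes ker: "\<And>j. (\<Sum>i\<in>UNIV. c i * (x i \<bullet> x j) ^ card T) = 0" and T: "finite T"
  shows "(\<Sum>i\<in>UNIV. c i * (\<Prod>t\<in>T. x i \<bullet> v t)) = 0"
proof -
  \<comment> \<open>\<open>M\<close> indexes the coordinates of a tensor, and \<open>S k\<close> is the \<open>k\<close>-th coordinate of \<open>S\<close>.\<close>
  define M where "M = T \<rightarrow>\<^sub>E (UNIV :: 'n set)"
  define S where "S k = (\<Sum>i\<in>UNIV. c i * (\<Prod>t\<in>T. x i $ k t))" for k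
  have fin: "finite M"
    unfolding M_def using T by (intro finite_PiE) auto
  have expand: "(\<Prod>t\<in>T. x i \<bullet> u t) = (\<Sum>k\<in>M. (\<Prod>t\<in>T. x i $ k t) * (\<Prod>t\<in>T. u t $ k t))" for i u
    unfolding M_def inner_vec_def using T
    by (simp add: prod_sum_PiE prod.distrib)
  have combine: "(\<Sum>i\<in>UNIV. c i * (\<Prod>t\<in>T. x i \<bullet> u t)) = (\<Sum>k\<in>M. S k * (\<Prod>t\<in>T. u t $ k t))" for u
    unfolding expand S_def sum_distrib_left sum_distrib_right
    by (subst sum.swap) (simp add: mult.assoc)
  have "(\<Sum>k\<in>M. S k * S k) = (\<Sum>k\<in>M. \<Sum>j\<in>UNIV. c j * (S k * (\<Prod>t\<in>T. x j $ k t)))"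
    by (subst (2) S_def) (simp add: sum_distrib_left mult_ac)
  also have "\<dots> = (\<Sum>j\<in>UNIV. c j * (\<Sum>k\<in>M. S k * (\<Prod>t\<in>T. x j $ k t)))"
    by (subst sum.swap) (simp add: sum_distrib_left)
  also have "\<dots> = (\<Sum>j\<in>UNIV. c j * (\<Sum>i\<in>UNIV. c i * (x i \<bullet> x j) ^ card T))"
    using combine[of "\<lambda>_. x j" for j, symmetric] by simp
  also have "\<dots> = 0"
    by (simp add: ker)
  finally have "\<forall>k\<in>M. S k = 0"
    using fin by (simp add: sum_nonneg_eq_0_iff)
  then show ?thesis
    by (simp add: combine)
qed

section \<open>Raising the degree\<close>

text \<open>
  If \<open>c\<close> is a relation in degree \<open>d + 1\<close>, then specializing one linear form to \<open>\<langle>\<cdot>, x\<^sub>i\<rangle>\<close> shows that the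
  numbers \<open>c\<^sub>k \<langle>x\<^sub>k, x\<^sub>i\<rangle>\<close> form a relation in degree \<open>d\<close>. So they all vanish, and the one with \<open>k = i\<close>
  yields \<open>c\<^sub>i = 0\<close>, because \<open>x\<^sub>i \<noteq> 0\<close>. For \<open>d = 0\<close> a single zero point would be a counterexample.
\<close>

lemma det_kernel_matrix_nonzero_Suc:
  fixes A :: "real ^ 'm ^ 'n"
  assumes nz: "det (kernel_matrix d A) \<noteq> 0" and d: "d \<ge> 1"
  shows "det (kernel_matrix (Suc d) A) \<noteq> 0"
  unfolding det_kernel_matrix_nonzero_iff
proof (intro allI impI)
  let ?x = "\<lambda>i. column i A"
  fix c :: "'m \<Rightarrow> real" and i
  assume c: "\<forall>j. (\<Sum>i\<in>UNIV. c i * (?x i \<bullet> ?x j) ^ Suc d) = 0"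
  note inj = nz[unfolded det_kernel_matrix_nonzero_iff, rule_format]
  \<comment> \<open>A zero column would produce a zero row of the kernel matrix, since \<open>d\<close> is positive.\<close>
  have "?x i \<noteq> 0"
  proof
    assume "?x i = 0"
    then have "(\<Sum>k\<in>UNIV. (if k = i then 1 else 0) * (?x k \<bullet> ?x j) ^ d) = 0" for j
      using d by (intro sum.neutral) auto
    from inj[of "\<lambda>k. if k = i then 1 else 0", OF this, of i] show False by simp
  qed
  have "(\<Sum>k\<in>UNIV. (c k * (?x k \<bullet> ?x i)) * (?x k \<bullet> ?x j) ^ d) = 0" for j
    using kernel_matrix_kernel_annihilates_products[of c ?x "{..<Suc d}" "\<lambda>t. if t = 0 then ?x i else ?x j"] c
    by (simp only: card_lessThan prod.lessThan_Suc_shift) (simp add: mult.assoc)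
  from inj[of "\<lambda>k. c k * (?x k \<bullet> ?x i)", OF this, of i] \<open>?x i \<noteq> 0\<close> show "c i = 0" by simp
qed

lemma det_kernel_matrix_nonzero_mono:
  fixes A :: "real ^ 'm ^ 'n"
  assumes "det (kernel_matrix d A) \<noteq> 0" "d \<ge> 1" "d \<le> e"
  shows "det (kernel_matrix e A) \<noteq> 0"
  using assms(3)
proof (induction e rule: dec_induct)
  case base
  show ?case by (fact assms(1))
next
  case (step n)
  from step.IH show ?case
    by (rule det_kernel_matrix_nonzero_Suc) (use step.hyps assms(2) in linarith)
qed

section \<open>Lattice points\<close>

text \<open>
  Multisets of size \<open>d\<close> encode the points with nonnegative integer coordinates of sum \<open>d\<close>,
  equivalently the monomials of degree \<open>d\<close>; their number is the binomial coefficient of the theorem.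
\<close>

definition lattice_point :: "'n::finite multiset \<Rightarrow> real ^ 'n" where
  "lattice_point X = (\<chi> k. real (count X k))"

lemma sum_count_UNIV: "(\<Sum>k\<in>UNIV. count X k) = size (X :: 'n::finite multiset)"
  unfolding size_multiset_overloaded_eq by (intro sum.mono_neutral_right) (auto simp: not_in_iff)

lemma count_less_if_size_eq:
  assumes "size X = size Y" "X \<noteq> Y"
  obtains k where "count X k < count Y k"
proof -
  have "\<not> Y \<subseteq># X"
    using assms by (metis mset_subset_size subset_mset.le_neq_trans less_irrefl)
  then show ?thesis
    using that by (auto simp: subseteq_mset_def not_le)
qed

text \<open>
  On the hyperplane of points with coordinate sum \<open>d\<close> the form \<open>z\<^sub>k - (s / d) \<Sum> z\<^sub>l\<close> agrees with
  \<open>z\<^sub>k - s\<close>. The product over all \<open>k\<close> and all \<open>s < count Y k\<close> therefore is nonzero at \<open>X\<close> exactly if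
  \<open>count X k \<ge> count Y k\<close> for all \<open>k\<close>, which for equal sizes forces \<open>X = Y\<close>. This is the basis of
  Lagrange interpolation on the principal lattice of a simplex, in homogeneous form.
\<close>

lemma lattice_point_dual_form:
  fixes Y :: "'n::finite multiset"
  assumes d: "size Y = d" "d \<ge> 1"
  obtains T :: "('n \<times> nat) set" and v where "finite T" "card T = d"
    "\<And>X. size X = d \<Longrightarrow> (\<Prod>t\<in>T. lattice_point X \<bullet> v t) = 0 \<longleftrightarrow> X \<noteq> Y"
proof
  define T where "T = (SIGMA k:UNIV. {..<count Y k})"
  define v where "v = (\<lambda>(k, s). axis k 1 - (real s / real d) *\<^sub>R (\<Sum>l\<in>UNIV. axis l 1) :: real ^ 'n)"
  show "finite T"
    by (simp add: T_def)
  show "card T = d"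
    using d by (simp add: T_def sum_count_UNIV)
  fix X :: "'n multiset" assume X: "size X = d"
  have "(\<Sum>l\<in>UNIV. lattice_point X $ l) = real d"
    using X by (simp add: lattice_point_def flip: of_nat_sum sum_count_UNIV)
  then have v: "lattice_point X \<bullet> v (k, s) = real (count X k) - real s" for k s
    using d by (simp add: v_def inner_diff_right inner_sum_right inner_axis lattice_point_def)
  have "(\<Prod>t\<in>T. lattice_point X \<bullet> v t) = 0 \<longleftrightarrow> (\<exists>t\<in>T. lattice_point X \<bullet> v t = 0)"
    using \<open>finite T\<close> by simp
  also have "\<dots> \<longleftrightarrow> (\<exists>k. count X k < count Y k)"
    by (auto simp: T_def v)
  also have "\<dots> \<longleftrightarrow> X \<noteq> Y"
    using X d by (metis count_less_if_size_eq less_irrefl)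
  finally show "(\<Prod>t\<in>T. lattice_point X \<bullet> v t) = 0 \<longleftrightarrow> X \<noteq> Y" .
qed

text \<open>
  Choose \<open>m\<close> distinct lattice points as columns. Evaluating a relation among their tensor powers at the
  dual product of linear forms of the \<open>i\<close>-th point isolates its \<open>i\<close>-th coefficient.
\<close>

lemma exists_nonsingular_kernel_matrix:
  assumes d: "d \<ge> 1" and card: "CARD('m::finite) \<le> (CARD('n::finite) + d - 1 choose d)"
  shows "\<exists>B :: real ^ 'm ^ 'n. det (kernel_matrix d B) \<noteq> 0"
proof -
  have "card (UNIV :: 'm set) \<le> card (multisets_of_size (UNIV :: 'n set) d)"
    using card by (simp add: card_multisets_of_size)
  then obtain X :: "'m \<Rightarrow> 'n multiset" where "inj X" "range X \<subseteq> multisets_of_size UNIV d"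
    using card_le_inj[of "UNIV :: 'm set" "multisets_of_size (UNIV :: 'n set) d"]
    by (auto simp: finite_multisets_of_size)
  then have X: "size (X i) = d" "X i = X j \<longleftrightarrow> i = j" for i j
    by (auto simp: multisets_of_size_def inj_eq)
  define B :: "real ^ 'm ^ 'n" where "B = (\<chi> k i. lattice_point (X i) $ k)"
  have B: "column i B = lattice_point (X i)" for i
    by (simp add: B_def column_def)
  have "det (kernel_matrix d B) \<noteq> 0"
    unfolding det_kernel_matrix_nonzero_iff B
  proof (intro allI impI)
    fix c and i :: 'm
    assume c: "\<forall>j. (\<Sum>i\<in>UNIV. c i * (lattice_point (X i) \<bullet> lattice_point (X j)) ^ d) = 0"
    obtain T :: "('n \<times> nat) set" and v where T: "finite T" "card T = d"
      and dual: "\<And>Z. size Z = d \<Longrightarrow> (\<Prod>t\<in>T. lattice_point Z \<bullet> v t) = 0 \<longleftrightarrow> Z \<noteq> X i"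
      using lattice_point_dual_form[OF X(1) d] by blast
    have "0 = (\<Sum>j\<in>UNIV. c j * (\<Prod>t\<in>T. lattice_point (X j) \<bullet> v t))"
      using kernel_matrix_kernel_annihilates_products[of c "\<lambda>i. lattice_point (X i)" T v] c T by simp
    also have "\<dots> = (\<Sum>j\<in>{i}. c j * (\<Prod>t\<in>T. lattice_point (X j) \<bullet> v t))"
      using X by (intro sum.mono_neutral_right) (auto simp: dual)
    finally show "c i = 0"
      using dual[of "X i"] X(1) by simp
  qed
  then show ?thesis ..
qed

section \<open>Interpolating labels\<close>

text \<open>
  Solve the linear system with the labels themselves as values: both labels are fixed points of the
  activation function. The factors \<open>y\<^sub>i\<close> in the perceptron are nonzero and are divided out.
\<close>

lemma perceptron_interpolates:
  fixes A :: "real ^ 'm ^ 'n"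
  assumes nz: "det (kernel_matrix d A) \<noteq> 0" and y: "\<forall>j. y j \<in> {- 1, 1}"
  shows "\<exists>\<alpha> b. \<forall>j. poly_kernel_perceptron A y d \<alpha> b (column j A) = y j"
proof -
  obtain x where x: "kernel_matrix d A *v x = (\<chi> j. y j)"
    using nz cramer by blast
  have [simp]: "y i \<noteq> 0" for i
    using y by (metis insert_iff neg_equal_0_iff_equal singletonD zero_neq_one)
  have "(\<Sum>i\<in>UNIV. x $ i / y i * y i * (column i A \<bullet> column j A) ^ d) = y j" for j
    using arg_cong[OF x, of "\<lambda>z. z $ j"]
    by (simp add: kernel_matrix_def matrix_vector_mult_def mult.commute)
  then have "poly_kernel_perceptron A y d (\<lambda>i. x $ i / y i) 0 (column j A) = y j" for j
    using y[rule_format, of j] by (auto simp: poly_kernel_perceptron_def activation_def)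
  then show ?thesis by blast
qed

theorem corollary5p5:
  assumes "CARD('m::finite) \<ge> CARD('n::finite)"
  shows "\<exists>\<A> :: (real ^ 'm ^ 'n) set. open \<A> \<and> closure \<A> = UNIV \<and>
    (\<forall>A\<in>\<A>. \<forall>y :: 'm \<Rightarrow> real. (\<forall>j. y j \<in> {- 1, 1}) \<longrightarrow>
      (\<forall>d :: nat. d \<ge> 1 \<and> (CARD('n) + d - 1 choose d) \<ge> CARD('m) \<longrightarrow>
        (\<exists>\<alpha> :: 'm \<Rightarrow> real. \<exists>b :: real.
          \<forall>j. poly_kernel_perceptron A y d \<alpha> b (column j A) = y j)))"
proof (cases "\<exists>d\<ge>1. (CARD('n) + d - 1 choose d) \<ge> CARD('m)")
  \<comment> \<open>No degree is admissible, which happens exactly for \<open>n = 1 < m\<close>.\<close>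
  case False
  then show ?thesis
    by (intro exI[of _ UNIV]) auto
next
  case True
  define good where "good d \<longleftrightarrow> d \<ge> 1 \<and> (CARD('n) + d - 1 choose d) \<ge> CARD('m)" for d
  define e where "e = Least good"
  have e: "good e"
    unfolding e_def by (rule LeastI_ex) (use True in \<open>simp only: good_def\<close>)
  have least: "e \<le> d" if "good d" for d
    unfolding e_def using that by (rule Least_le)
  define \<A> :: "(real ^ 'm ^ 'n) set" where "\<A> = {A. det (kernel_matrix e A) \<noteq> 0}"
  obtain B :: "real ^ 'm ^ 'n" where B: "det (kernel_matrix e B) \<noteq> 0"
    using exists_nonsingular_kernel_matrix e unfolding good_def by metis
  have "open \<A>" "closure \<A> = UNIV"
    unfolding \<A>_def
    by (rule open_dense_nonzero_polynomial[OF real_polynomial_function_det_kernel_matrix B])+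
  show ?thesis
  proof (intro exI[of _ \<A>] conjI ballI allI impI)
    show "open \<A>" "closure \<A> = UNIV" by fact+
    fix A and y :: "'m \<Rightarrow> real" and d
    assume A: "A \<in> \<A>" and y: "\<forall>j. y j \<in> {- 1, 1}"
      and "d \<ge> 1 \<and> (CARD('n) + d - 1 choose d) \<ge> CARD('m)"
    then have "e \<le> d"
      by (intro least) (simp only: good_def)
    have "det (kernel_matrix e A) \<noteq> 0" "e \<ge> 1"
      using A e unfolding \<A>_def good_def by blast+
    from det_kernel_matrix_nonzero_mono[OF this \<open>e \<le> d\<close>]
    show "\<exists>\<alpha> b. \<forall>j. poly_kernel_perceptron A y d \<alpha> b (column j A) = y j"
      using y by (rule perceptron_interpolates)
  qed
qed

end
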